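(* Let $\omega:\mathbb N\to[1,\infty)$ be a weight, i.e., $\omega(mn)\le\omega(m)\omega(n)$ for all $m,n\in\mathbb N$, and let $A_\omega$ be the weighted Banach algebra of Dirichlet series (equivalently, $\ell^1(\mathbb N,\omega)$ with Dirichlet convolution). Then $\|\widehat f\|_{\operatorname{BSE}}=\|f\|_\omega$ for all $f\in A_\omega$.
   Context: $\mathbb N=\{1,2,3,\ldots\}$, regarded as a semigroup under multiplication. For a weight $\omega:\mathbb N\to[1,\infty)$, $A_\omega$ is the collection of all functions $f:\mathbb H\to\mathbb C$, where $\mathbb H=\{x+iy\in\mathbb C:x\ge0\}$, that can be represented as $f(s)=\sum_{n=1}^\infty a(n)n^{-s}$ for all $s\in\mathbb H$ with $\|f\|_\omega=\sum_{n=1}^\infty|a(n)|\omega(n)<\infty$; it is a unital commutative Banach algebra under pointwise multiplication. It is isometrically isomorphic, via $(a(n))\mapsto\sum_n a(n)n^{-s}$, to $\ell^1(\mathbb N,\omega)=\{f=(a(n)):\mathbb N\to\mathbb C:\|f\|_\omega=\sum_n|a(n)|\omega(n)<\infty\}$ with the Dirichlet convolution $(f\star g)(n)=\sum_{d\mid n}f(d)g(n/d)$. For a commutative Banach algebra $A$, $\Phi_A$ is the set of all nonzero linear functionals $\varphi:A\to\mathbb C$ with $\varphi(ab)=\varphi(a)\varphi(b)$ for all $a,b\in A$. For $a\in A$, the Gel'fand transform $\widehat a:\Phi_A\to\mathbb C$ is $\widehat a(\varphi)=\varphi(a)$, and $\Phi_A$ carries the Gel'fand topology, the weakest topology making all $\widehat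 a$ $(a\in A)$ continuous. A continuous function $\sigma:\Phi_A\to\mathbb C$ is a BSE-function if there is a constant $C>0$ such that $\left|\sum_{i=1}^n c_i\sigma(\varphi_i)\right|\le C\left\|\sum_{i=1}^n c_i\varphi_i\right\|_{A^\ast}$ for all $n\in\mathbb N$, $\varphi_1,\ldots,\varphi_n\in\Phi_A$ and $c_1,\ldots,c_n\in\mathbb C$. The BSE-norm $\|\sigma\|_{\operatorname{BSE}}$ is the smallest (infimum) such $C$. *)

theory Defs
  imports "HOL-Analysis.Analysis"
begin

text \<open>The index semigroup is the set of positive naturals, written \<open>{1..}\<close>;
  values of sequences and weights at 0 never matter.\<close>

definition weight :: "(nat \<Rightarrow> real) \<Rightarrow> bool" where
  "weight \<omega> \<longleftrightarrow>
     (\<forall>n\<ge>1. 1 \<le> \<omega> n) \<and> (\<forall>m\<ge>1. \<forall>n\<ge>1. \<omega> (m * n) \<le> \<omega> m * \<omega> n)"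

definition closed_right_half_plane :: "complex set" where
  "closed_right_half_plane = {s. 0 \<le> Re s}"

text \<open>A function on the closed right half-plane is encoded as a function on all of \<open>\<complex>\<close>
  that vanishes outside of it, so that the pointwise operations preserve the encoding.\<close>

definition dirichlet_rep ::
    "(nat \<Rightarrow> real) \<Rightarrow> (nat \<Rightarrow> complex) \<Rightarrow> (complex \<Rightarrow> complex) \<Rightarrow> bool" where
  "dirichlet_rep \<omega> a f \<longleftrightarrow>
     (\<lambda>n. cmod (a n) * \<omega> n) summable_on {1..} \<and>
     (\<forall>s\<in>closed_right_half_plane. ((\<lambda>n. a n * of_nat n powr (- s)) has_sum f s) {1..}) \<and>
     (\<forall>s. s \<notin> closed_right_half_plane \<longrightarrow> f s = 0)"

definition dirichlet_algebra :: "(nat \<Rightarrow> real) \<Rightarrow> (complex \<Rightarrow> complex) set" where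
  "dirichlet_algebra \<omega> = {f. \<exists>a. dirichlet_rep \<omega> a f}"

text \<open>The description is definite because the coefficients \<open>a n\<close> with \<open>n \<ge> 1\<close>
  of a Dirichlet series are determined by its sum.\<close>

definition dirichlet_norm :: "(nat \<Rightarrow> real) \<Rightarrow> (complex \<Rightarrow> complex) \<Rightarrow> real" where
  "dirichlet_norm \<omega> f =
     (THE r. \<exists>a. dirichlet_rep \<omega> a f \<and> r = (\<Sum>\<^sub>\<infinity>n\<in>{1..}. cmod (a n) * \<omega> n))"

text \<open>In the following, \<open>A\<close> is the carrier of an algebra of complex-valued functions
  with pointwise operations, and \<open>N\<close> is its (complete, submultiplicative) norm.
  A functional on \<open>A\<close> is a HOL function that is \<open>undefined\<close> off \<open>A\<close>, so that functionals
  which agree on \<open>A\<close> are equal. Continuity of characters is not required; it is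
  automatic on a Banach algebra.\<close>

definition char_space :: "('x \<Rightarrow> complex) set \<Rightarrow> (('x \<Rightarrow> complex) \<Rightarrow> complex) set" where
  "char_space A =
     {\<phi> \<in> extensional A.
        (\<forall>f\<in>A. \<forall>g\<in>A. \<phi> (\<lambda>x. f x + g x) = \<phi> f + \<phi> g) \<and>
        (\<forall>c. \<forall>f\<in>A. \<phi> (\<lambda>x. c * f x) = c * \<phi> f) \<and>
        (\<forall>f\<in>A. \<forall>g\<in>A. \<phi> (\<lambda>x. f x * g x) = \<phi> f * \<phi> g) \<and>
        (\<exists>f\<in>A. \<phi> f \<noteq> 0)}"

definition gelfand_transform ::
    "('x \<Rightarrow> complex) set \<Rightarrow> ('x \<Rightarrow> complex) \<Rightarrow> (('x \<Rightarrow> complex) \<Rightarrow> complex) \<Rightarrow> complex" where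
  "gelfand_transform A f = (\<lambda>\<phi>\<in>char_space A. \<phi> f)"

definition gelfand_topology ::
    "('x \<Rightarrow> complex) set \<Rightarrow> (('x \<Rightarrow> complex) \<Rightarrow> complex) topology" where
  "gelfand_topology A =
     topology_generated_by
       {{\<phi> \<in> char_space A. gelfand_transform A f \<phi> \<in> U} | f U. f \<in> A \<and> open U}"

lemma topspace_gelfand_topology: "topspace (gelfand_topology A) = char_space A"
proof
  show "topspace (gelfand_topology A) \<subseteq> char_space A"
    by (auto simp: gelfand_topology_def)
  show "char_space A \<subseteq> topspace (gelfand_topology A)"
  proof
    fix \<phi> assume \<phi>: "\<phi> \<in> char_space A"
    then obtain f where "f \<in> A"
      by (auto simp: char_space_def)
    then have "{\<psi> \<in> char_space A. gelfand_transform A f \<psi> \<in> UNIV} \<in>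
        {{\<phi> \<in> char_space A. gelfand_transform A f \<phi> \<in> U} | f U. f \<in> A \<and> open U}"
      using open_UNIV by blast
    with \<phi> show "\<phi> \<in> topspace (gelfand_topology A)"
      unfolding gelfand_topology_def topology_generated_by_topspace by (intro UnionI) auto
  qed
qed

text \<open>The supremum is over a bounded set for every continuous \<open>\<psi>\<close>, in particular for every
  linear combination of characters of a Banach algebra.\<close>

definition dual_norm ::
    "('x \<Rightarrow> complex) set \<Rightarrow> (('x \<Rightarrow> complex) \<Rightarrow> real) \<Rightarrow> (('x \<Rightarrow> complex) \<Rightarrow> complex) \<Rightarrow> real" where
  "dual_norm A N \<psi> = Sup {cmod (\<psi> f) | f. f \<in> A \<and> N f \<le> 1}"

definition bse_bound ::
    "('x \<Rightarrow> complex) set \<Rightarrow> (('x \<Rightarrow> complex) \<Rightarrow> real) \<Rightarrow>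
     ((('x \<Rightarrow> complex) \<Rightarrow> complex) \<Rightarrow> complex) \<Rightarrow> real \<Rightarrow> bool" where
  "bse_bound A N \<sigma> C \<longleftrightarrow>
     0 < C \<and>
     (\<forall>n\<ge>1. \<forall>(\<phi> :: nat \<Rightarrow> ('x \<Rightarrow> complex) \<Rightarrow> complex) (c :: nat \<Rightarrow> complex).
        (\<forall>i\<in>{1..n}. \<phi> i \<in> char_space A) \<longrightarrow>
        cmod (\<Sum>i=1..n. c i * \<sigma> (\<phi> i)) \<le> C * dual_norm A N (\<lambda>f. \<Sum>i=1..n. c i * \<phi> i f))"

definition bse_function ::
    "('x \<Rightarrow> complex) set \<Rightarrow> (('x \<Rightarrow> complex) \<Rightarrow> real) \<Rightarrow>
     ((('x \<Rightarrow> complex) \<Rightarrow> complex) \<Rightarrow> complex) \<Rightarrow> bool" where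
  "bse_function A N \<sigma> \<longleftrightarrow>
     continuous_map (gelfand_topology A) euclidean \<sigma> \<and> (\<exists>C. bse_bound A N \<sigma> C)"

text \<open>Meaningful only for \<open>bse_function A N \<sigma>\<close>; otherwise the set may be empty.\<close>

definition bse_norm ::
    "('x \<Rightarrow> complex) set \<Rightarrow> (('x \<Rightarrow> complex) \<Rightarrow> real) \<Rightarrow>
     ((('x \<Rightarrow> complex) \<Rightarrow> complex) \<Rightarrow> complex) \<Rightarrow> real" where
  "bse_norm A N \<sigma> = Inf {C. bse_bound A N \<sigma> C}"

end

theory Submission
  imports Defs
begin

text \<open>The dual of \<open>\<ell>\<^sup>1(\<nat>, \<omega>)\<close> consists of the functions \<open>p\<close> on \<open>\<nat>\<close> with
  \<open>\<bar>p n\<bar> \<le> C * \<omega> n\<close>. Among the characters are the evaluations at the integers \<open>s = 0, 1, 2, \<dots>\<close>,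
  and their linear combinations are the functions \<open>n \<mapsto> P (1 / n)\<close> with \<open>P\<close> a polynomial. Given
  \<open>N\<close>, Lagrange interpolation at the nodes \<open>1 / m\<close>, \<open>m \<le> N\<close>, with the \<open>m\<close>-th basis polynomial multiplied by
  \<open>(m * x) ^ k\<close>, prescribes \<open>P (1 / n)\<close> for all \<open>n \<le> N\<close>, while \<open>\<bar>P (1 / n)\<bar> \<le> 1 \<le> \<omega> n\<close>
  for \<open>n > N\<close> once \<open>k\<close> is large. Prescribing the values \<open>cnj (sgn (a n)) * \<omega> n\<close> gives combinations
  of characters of dual norm at most 1 that almost attain \<open>\<parallel>f\<parallel>\<close> at the series \<open>f\<close> with coefficients
  \<open>a\<close>; in particular the norm does not depend on the choice of coefficients. The opposite inequality
  holds because characters are automatically contractive, by the Neumann series.\<close>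

section \<open>The algebra of Dirichlet series\<close>

text \<open>Attached to a coefficient sequence rather than to a function:
  \<open>dirichlet_norm\<close> is a definite description and can be evaluated only after
  \<open>coeff_norm_unique\<close>.\<close>

definition coeff_norm :: "(nat \<Rightarrow> real) \<Rightarrow> (nat \<Rightarrow> complex) \<Rightarrow> real" where
  "coeff_norm \<omega> a = (\<Sum>\<^sub>\<infinity>n\<in>{1..}. cmod (a n) * \<omega> n)"

lemma weight_ge_1: "weight \<omega> \<Longrightarrow> 1 \<le> n \<Longrightarrow> 1 \<le> \<omega> n"
  by (simp add: weight_def)

lemma weight_nonneg: "weight \<omega> \<Longrightarrow> 1 \<le> n \<Longrightarrow> 0 \<le> \<omega> n"
  using weight_ge_1 by fastforce

lemma coeff_norm_nonneg: "weight \<omega> \<Longrightarrow> 0 \<le> coeff_norm \<omega> a"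
  unfolding coeff_norm_def by (intro infsum_nonneg mult_nonneg_nonneg) (auto simp: weight_nonneg)

lemma norm_nat_powr_le_1:
  assumes "0 \<le> Re s" "1 \<le> n"
  shows "cmod (of_nat n powr (- s)) \<le> 1"
proof -
  have "cmod (of_nat n powr (- s)) = real n powr (- Re s)"
    using assms by (subst norm_powr_real_powr) auto
  also have "\<dots> \<le> real n powr 0"
    using assms by (intro powr_mono) auto
  finally show ?thesis using assms by simp
qed

lemma of_nat_mult_powr:
  "(of_nat (m * n) :: complex) powr s = of_nat m powr s * of_nat n powr s"
  by (simp add: powr_times_real)

text \<open>Both products and Neumann series rearrange a Dirichlet series over a larger index set.\<close>

lemma dirichlet_rep_regroup:
  fixes I :: "'i set" and \<nu> :: "'i \<Rightarrow> nat" and c :: "'i \<Rightarrow> complex"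
  assumes w: "weight \<omega>"
    and \<nu>: "\<And>i. i \<in> I \<Longrightarrow> 1 \<le> \<nu> i"
    and summ: "(\<lambda>i. cmod (c i) * \<omega> (\<nu> i)) summable_on I"
    and F: "\<And>s. s \<in> closed_right_half_plane \<Longrightarrow>
              ((\<lambda>i. c i * of_nat (\<nu> i) powr (- s)) has_sum F s) I"
    and F0: "\<And>s. s \<notin> closed_right_half_plane \<Longrightarrow> F s = 0"
  shows "\<exists>a. dirichlet_rep \<omega> a F \<and> coeff_norm \<omega> a \<le> (\<Sum>\<^sub>\<infinity>i\<in>I. cmod (c i) * \<omega> (\<nu> i))"
proof -
  \<comment> \<open>The fibres of \<open>\<nu>\<close> partition \<open>I\<close>. Summing
    \<open>c\<close> over the fibre of \<open>n\<close> merges all terms with the same factor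
    \<open>n powr (- s)\<close> into one coefficient \<open>a n\<close>.\<close>
  define J where "J n = {i \<in> I. \<nu> i = n}" for n
  define a where "a n = infsum c (J n)" for n
  have bij: "bij_betw snd (Sigma {1..} J) I"
    by (rule bij_betwI[where g = "\<lambda>i. (\<nu> i, i)"]) (use \<nu> in \<open>auto simp: J_def\<close>)
  note regroup = has_sum_reindex_bij_betw[OF bij, THEN iffD2]
  have c_abs: "(\<lambda>i. cmod (c i)) summable_on I"
  proof (rule summable_on_comparison_test[OF summ])
    fix i assume "i \<in> I"
    then show "cmod (c i) \<le> cmod (c i) * \<omega> (\<nu> i)"
      using weight_ge_1[OF w \<nu>] by (simp add: mult_le_cancel_left1)
  qed auto
  have c_absJ: "(\<lambda>i. cmod (c i)) summable_on J n" for n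
    by (rule summable_on_subset[OF c_abs]) (auto simp: J_def)
  have cJ: "(c has_sum a n) (J n)" for n
    unfolding a_def using abs_summable_summable[OF c_absJ] by (rule has_sum_infsum)
  \<comment> \<open>A majorant of \<open>a\<close> whose weighted sum is exactly the given sum over
    \<open>I\<close>, because \<open>\<omega> (\<nu> i)\<close> is constant on each fibre.\<close>
  define M where "M n = (\<Sum>\<^sub>\<infinity>i\<in>J n. cmod (c i))" for n
  have M: "((\<lambda>i. cmod (c i)) has_sum M n) (J n)" for n
    unfolding M_def using c_absJ by (rule has_sum_infsum)
  have aM: "cmod (a n) \<le> M n" for n
    by (rule norm_has_sum_bound[OF M cJ])
  have "((\<lambda>p. cmod (c (snd p)) * \<omega> (\<nu> (snd p))) has_sum (\<Sum>\<^sub>\<infinity>i\<in>I. cmod (c i) * \<omega> (\<nu> i)))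
          (Sigma {1..} J)"
    by (rule regroup[OF has_sum_infsum[OF summ]])
  moreover have "((\<lambda>i. cmod (c (snd (n, i))) * \<omega> (\<nu> (snd (n, i)))) has_sum M n * \<omega> n) (J n)" for n
  proof -
    have "((\<lambda>i. cmod (c i) * \<omega> n) has_sum M n * \<omega> n) (J n)"
      by (rule has_sum_cmult_left[OF M])
    then show ?thesis
      by (rule has_sum_cong[THEN iffD1, rotated]) (auto simp: J_def)
  qed
  ultimately have MS: "((\<lambda>n. M n * \<omega> n) has_sum (\<Sum>\<^sub>\<infinity>i\<in>I. cmod (c i) * \<omega> (\<nu> i))) {1..}"
    by (rule has_sum_SigmaD)
  have le: "cmod (a n) * \<omega> n \<le> M n * \<omega> n" if "n \<in> {1..}" for n
    using aM weight_nonneg[OF w] that by (intro mult_right_mono) auto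
  have asum: "(\<lambda>n. cmod (a n) * \<omega> n) summable_on {1..}"
    by (rule summable_on_comparison_test[OF has_sum_imp_summable[OF MS] le])
      (use weight_nonneg[OF w] in auto)
  have "coeff_norm \<omega> a \<le> (\<Sum>\<^sub>\<infinity>i\<in>I. cmod (c i) * \<omega> (\<nu> i))"
    unfolding coeff_norm_def by (rule has_sum_mono[OF has_sum_infsum[OF asum] MS le])
  moreover have "((\<lambda>n. a n * of_nat n powr (- s)) has_sum F s) {1..}"
    if s: "s \<in> closed_right_half_plane" for s
  proof (rule has_sum_SigmaD)
    show "((\<lambda>p. c (snd p) * of_nat (\<nu> (snd p)) powr (- s)) has_sum F s) (Sigma {1..} J)"
      by (rule regroup[OF F[OF s]])
    fix n :: nat
    have "((\<lambda>i. c i * of_nat n powr (- s)) has_sum a n * of_nat n powr (- s)) (J n)"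
      by (rule has_sum_cmult_left[OF cJ])
    then show "((\<lambda>i. c (snd (n, i)) * of_nat (\<nu> (snd (n, i))) powr (- s))
                 has_sum a n * of_nat n powr (- s)) (J n)"
      by (rule has_sum_cong[THEN iffD1, rotated]) (auto simp: J_def)
  qed
  ultimately show ?thesis
    using asum F0 by (auto simp: dirichlet_rep_def)
qed

section \<open>Norm estimates and algebra operations on Dirichlet series\<close>

lemma dirichlet_rep_has_sum:
  "dirichlet_rep \<omega> a f \<Longrightarrow> s \<in> closed_right_half_plane \<Longrightarrow>
    ((\<lambda>n. a n * of_nat n powr (- s)) has_sum f s) {1..}"
  by (simp add: dirichlet_rep_def)

lemma dirichlet_rep_summable:
  "dirichlet_rep \<omega> a f \<Longrightarrow> (\<lambda>n. cmod (a n) * \<omega> n) summable_on {1..}"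
  by (simp add: dirichlet_rep_def)

lemma dirichlet_rep_outside:
  "dirichlet_rep \<omega> a f \<Longrightarrow> s \<notin> closed_right_half_plane \<Longrightarrow> f s = 0"
  by (simp add: dirichlet_rep_def)

lemma coeff_norm_has_sum:
  "dirichlet_rep \<omega> a f \<Longrightarrow> ((\<lambda>n. cmod (a n) * \<omega> n) has_sum coeff_norm \<omega> a) {1..}"
  unfolding coeff_norm_def by (intro has_sum_infsum dirichlet_rep_summable)

text \<open>On the half-plane \<open>n powr (- s)\<close> has modulus at most 1, hence at most
  \<open>\<omega> n\<close>; elsewhere \<open>f\<close> vanishes. This makes the Neumann series of
  \<open>h\<close> converge pointwise when its coefficient norm is below 1.\<close>

lemma dirichlet_rep_norm_le:
  assumes w: "weight \<omega>" and a: "dirichlet_rep \<omega> a f"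
  shows "cmod (f s) \<le> coeff_norm \<omega> a"
proof (cases "s \<in> closed_right_half_plane")
  case s: True
  have le: "cmod (a n * of_nat n powr (- s)) \<le> cmod (a n) * \<omega> n" if "n \<in> {1..}" for n
    using norm_nat_powr_le_1[of s n] weight_ge_1[OF w, of n] that s
    by (auto simp: norm_mult closed_right_half_plane_def intro!: mult_left_mono)
  have "(\<lambda>n. cmod (a n * of_nat n powr (- s))) summable_on {1..}"
    by (rule summable_on_comparison_test[OF dirichlet_rep_summable[OF a] le]) auto
  note hs = has_sum_infsum[OF this]
  have "cmod (f s) \<le> (\<Sum>\<^sub>\<infinity>n\<in>{1..}. cmod (a n * of_nat n powr (- s)))"
    by (rule norm_has_sum_bound[OF hs dirichlet_rep_has_sum[OF a s]])
  also have "\<dots> \<le> coeff_norm \<omega> a"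
    by (rule has_sum_mono[OF hs coeff_norm_has_sum[OF a] le])
  finally show ?thesis .
qed (use dirichlet_rep_outside[OF a] coeff_norm_nonneg[OF w] in auto)

lemma dirichlet_rep_cmult:
  assumes "dirichlet_rep \<omega> a f"
  shows "dirichlet_rep \<omega> (\<lambda>n. c * a n) (\<lambda>s. c * f s)"
    and "coeff_norm \<omega> (\<lambda>n. c * a n) = cmod c * coeff_norm \<omega> a"
proof -
  have "((\<lambda>n. cmod c * (cmod (a n) * \<omega> n)) has_sum cmod c * coeff_norm \<omega> a) {1..}"
    by (rule has_sum_cmult_right[OF coeff_norm_has_sum[OF assms]])
  then have hs: "((\<lambda>n. cmod (c * a n) * \<omega> n) has_sum cmod c * coeff_norm \<omega> a) {1..}"
    by (simp add: norm_mult mult.assoc)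
  show "coeff_norm \<omega> (\<lambda>n. c * a n) = cmod c * coeff_norm \<omega> a"
    using infsumI[OF hs] by (simp add: coeff_norm_def)
  have "((\<lambda>n. c * a n * of_nat n powr (- s)) has_sum c * f s) {1..}"
    if "s \<in> closed_right_half_plane" for s
    using has_sum_cmult_right[OF dirichlet_rep_has_sum[OF assms that], of c]
    by (simp add: mult.assoc)
  then show "dirichlet_rep \<omega> (\<lambda>n. c * a n) (\<lambda>s. c * f s)"
    using has_sum_imp_summable[OF hs] dirichlet_rep_outside[OF assms]
    by (simp add: dirichlet_rep_def)
qed

lemma dirichlet_rep_add:
  assumes w: "weight \<omega>" and a: "dirichlet_rep \<omega> a f" and b: "dirichlet_rep \<omega> b g"
  shows "dirichlet_rep \<omega> (\<lambda>n. a n + b n) (\<lambda>s. f s + g s)"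
proof -
  have "(\<lambda>n. cmod (a n) * \<omega> n + cmod (b n) * \<omega> n) summable_on {1..}"
    by (intro summable_on_add dirichlet_rep_summable[OF a] dirichlet_rep_summable[OF b])
  then have "(\<lambda>n. cmod (a n + b n) * \<omega> n) summable_on {1..}"
  proof (rule summable_on_comparison_test)
    fix n :: nat assume n: "n \<in> {1..}"
    have "cmod (a n + b n) * \<omega> n \<le> (cmod (a n) + cmod (b n)) * \<omega> n"
      using n weight_nonneg[OF w] by (intro mult_right_mono norm_triangle_ineq) auto
    then show "cmod (a n + b n) * \<omega> n \<le> cmod (a n) * \<omega> n + cmod (b n) * \<omega> n"
      by (simp add: algebra_simps)
  qed (use weight_nonneg[OF w] in auto)
  moreover have "((\<lambda>n. (a n + b n) * of_nat n powr (- s)) has_sum f s + g s) {1..}"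
    if "s \<in> closed_right_half_plane" for s
    using has_sum_add[OF dirichlet_rep_has_sum[OF a that] dirichlet_rep_has_sum[OF b that]]
    by (simp add: algebra_simps)
  ultimately show ?thesis
    using dirichlet_rep_outside[OF a] dirichlet_rep_outside[OF b] by (simp add: dirichlet_rep_def)
qed

text \<open>The product is a double series over pairs \<open>(m, n)\<close>; regrouping it by
  \<open>m * n\<close> yields the Dirichlet convolution. The norm estimate comes from
  submultiplicativity of \<open>\<omega>\<close>.\<close>

lemma dirichlet_rep_mult:
  assumes w: "weight \<omega>" and a: "dirichlet_rep \<omega> a f" and b: "dirichlet_rep \<omega> b g"
  shows "\<exists>c. dirichlet_rep \<omega> c (\<lambda>s. f s * g s) \<and>
             coeff_norm \<omega> c \<le> coeff_norm \<omega> a * coeff_norm \<omega> b"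
proof -
  let ?N = "{1::nat..}"
  define \<nu> where "\<nu> p = fst p * snd p" for p :: "nat \<times> nat"
  define c where "c p = a (fst p) * b (snd p)" for p
  \<comment> \<open>This majorant factors, so its double sum is the product of the two
    norms.\<close>
  define W where "W p = (cmod (a (fst p)) * \<omega> (fst p)) * (cmod (b (snd p)) * \<omega> (snd p))" for p
  have row: "((\<lambda>n. W (m, n)) has_sum (cmod (a m) * \<omega> m) * coeff_norm \<omega> b) ?N" for m
    using has_sum_cmult_right[OF coeff_norm_has_sum[OF b]] by (simp add: W_def)
  have col: "((\<lambda>m. (cmod (a m) * \<omega> m) * coeff_norm \<omega> b)
               has_sum coeff_norm \<omega> a * coeff_norm \<omega> b) ?N"
    by (rule has_sum_cmult_left[OF coeff_norm_has_sum[OF a]])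
  have W0: "0 \<le> W p" if "p \<in> ?N \<times> ?N" for p
    using that weight_nonneg[OF w] by (auto simp: W_def)
  have Wsum: "W summable_on ?N \<times> ?N"
    by (rule summable_on_SigmaI[OF row has_sum_imp_summable[OF col] W0]) auto
  have Whs: "(W has_sum coeff_norm \<omega> a * coeff_norm \<omega> b) (?N \<times> ?N)"
    by (rule has_sum_SigmaI[OF row col Wsum])
  have le: "cmod (c p) * \<omega> (\<nu> p) \<le> W p" if "p \<in> ?N \<times> ?N" for p
  proof -
    have "\<omega> (\<nu> p) \<le> \<omega> (fst p) * \<omega> (snd p)"
      using w that by (auto simp: weight_def \<nu>_def)
    then have "cmod (c p) * \<omega> (\<nu> p) \<le> cmod (c p) * (\<omega> (fst p) * \<omega> (snd p))"
      by (intro mult_left_mono) auto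
    then show ?thesis
      by (simp add: c_def W_def norm_mult mult_ac)
  qed
  have \<nu>1: "1 \<le> \<nu> p" if "p \<in> ?N \<times> ?N" for p
    using that by (auto simp: \<nu>_def Suc_le_eq)
  have csum: "(\<lambda>p. cmod (c p) * \<omega> (\<nu> p)) summable_on ?N \<times> ?N"
    by (rule summable_on_comparison_test[OF Wsum le]) (use weight_nonneg[OF w \<nu>1] in auto)
  have "((\<lambda>p. c p * of_nat (\<nu> p) powr (- s)) has_sum f s * g s) (?N \<times> ?N)"
    if s: "s \<in> closed_right_half_plane" for s
  proof (rule has_sum_SigmaI)
    have "(\<lambda>p. cmod (c p * of_nat (\<nu> p) powr (- s))) summable_on ?N \<times> ?N"
    proof (rule summable_on_comparison_test[OF csum])
      fix p assume p: "p \<in> ?N \<times> ?N"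
      show "cmod (c p * of_nat (\<nu> p) powr (- s)) \<le> cmod (c p) * \<omega> (\<nu> p)"
        using norm_nat_powr_le_1[of s "\<nu> p"] weight_ge_1[OF w \<nu>1[OF p]] \<nu>1[OF p] s
        by (auto simp: norm_mult closed_right_half_plane_def intro!: mult_left_mono)
    qed auto
    then show "(\<lambda>p. c p * of_nat (\<nu> p) powr (- s)) summable_on ?N \<times> ?N"
      by (rule abs_summable_summable)
    show "((\<lambda>m. (a m * of_nat m powr (- s)) * g s) has_sum f s * g s) ?N"
      by (rule has_sum_cmult_left[OF dirichlet_rep_has_sum[OF a s]])
    fix m :: nat
    have "((\<lambda>n. (a m * of_nat m powr (- s)) * (b n * of_nat n powr (- s)))
            has_sum (a m * of_nat m powr (- s)) * g s) ?N"
      by (rule has_sum_cmult_right[OF dirichlet_rep_has_sum[OF b s]])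
    then show "((\<lambda>n. c (m, n) * of_nat (\<nu> (m, n)) powr (- s))
            has_sum (a m * of_nat m powr (- s)) * g s) ?N"
      by (simp add: c_def \<nu>_def of_nat_mult_powr mult_ac del: of_nat_mult)
  qed
  from dirichlet_rep_regroup[OF w \<nu>1 csum this]
  obtain d where d: "dirichlet_rep \<omega> d (\<lambda>s. f s * g s)"
    "coeff_norm \<omega> d \<le> (\<Sum>\<^sub>\<infinity>p\<in>?N \<times> ?N. cmod (c p) * \<omega> (\<nu> p))"
    using dirichlet_rep_outside[OF a] by auto
  have "(\<Sum>\<^sub>\<infinity>p\<in>?N \<times> ?N. cmod (c p) * \<omega> (\<nu> p)) \<le> coeff_norm \<omega> a * coeff_norm \<omega> b"
    by (rule has_sum_mono[OF has_sum_infsum[OF csum] Whs le])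
  with d show ?thesis by (intro exI[of _ d]) auto
qed

section \<open>The unit and Neumann series\<close>

text \<open>The unit of the algebra is an indicator rather than the constant 1, since elements
  vanish off the half-plane.\<close>

definition dirichlet_one :: "complex \<Rightarrow> complex" where
  "dirichlet_one = indicator closed_right_half_plane"

lemma dirichlet_rep_one:
  "dirichlet_rep \<omega> (\<lambda>n. if n = 1 then 1 else 0) dirichlet_one"
  "coeff_norm \<omega> (\<lambda>n. if n = 1 then 1 else 0) = \<omega> 1"
proof -
  have hs: "((\<lambda>n. cmod (if n = 1 then 1 else 0) * \<omega> n) has_sum \<omega> 1) {1..}"
    by (rule has_sum_finite_neutralI[of "{1}"]) auto
  show "coeff_norm \<omega> (\<lambda>n. if n = 1 then 1 else 0) = \<omega> 1"
    unfolding coeff_norm_def by (rule infsumI[OF hs])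
  have "((\<lambda>n. (if n = 1 then 1 else 0) * of_nat n powr (- s)) has_sum 1) {1..}" for s :: complex
    by (rule has_sum_finite_neutralI[of "{1}"]) auto
  then show "dirichlet_rep \<omega> (\<lambda>n. if n = 1 then 1 else 0) dirichlet_one"
    using has_sum_imp_summable[OF hs] by (auto simp: dirichlet_rep_def dirichlet_one_def)
qed

text \<open>The factor \<open>dirichlet_one\<close> keeps the power with \<open>k = 0\<close> in the
  algebra, and \<open>\<omega> 1\<close> is the norm of that unit, which may exceed 1.\<close>

lemma dirichlet_rep_power:
  assumes w: "weight \<omega>" and a: "dirichlet_rep \<omega> a h"
  shows "\<exists>b. dirichlet_rep \<omega> b (\<lambda>s. dirichlet_one s * h s ^ k) \<and>
             coeff_norm \<omega> b \<le> \<omega> 1 * coeff_norm \<omega> a ^ k"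
proof (induction k)
  case 0
  then show ?case using dirichlet_rep_one[of \<omega>] by auto
next
  case (Suc k)
  then obtain b where b: "dirichlet_rep \<omega> b (\<lambda>s. dirichlet_one s * h s ^ k)"
    "coeff_norm \<omega> b \<le> \<omega> 1 * coeff_norm \<omega> a ^ k" by blast
  from dirichlet_rep_mult[OF w a b(1)] obtain c where
    c: "dirichlet_rep \<omega> c (\<lambda>s. h s * (dirichlet_one s * h s ^ k))"
    "coeff_norm \<omega> c \<le> coeff_norm \<omega> a * coeff_norm \<omega> b" by blast
  note c(2)
  also have "coeff_norm \<omega> a * coeff_norm \<omega> b \<le> coeff_norm \<omega> a * (\<omega> 1 * coeff_norm \<omega> a ^ k)"
    by (intro mult_left_mono b coeff_norm_nonneg[OF w])
  finally show ?case using c(1) by (intro exI[of _ c]) (simp add: mult_ac)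
qed

text \<open>\<open>g\<close> is the sum of the powers of \<open>h\<close>. The coefficients of all
  powers form a double series over \<open>(k, n)\<close>, dominated in norm by a geometric series,
  and regrouping it by \<open>n\<close> gives coefficients for \<open>g\<close>. A character with
  value 1 at \<open>h\<close> is incompatible with this equation, as
  \<open>char_space_le_norm\<close> exploits.\<close>

lemma dirichlet_neumann:
  assumes w: "weight \<omega>" and a: "dirichlet_rep \<omega> a h" and lt: "coeff_norm \<omega> a < 1"
  shows "\<exists>g\<in>dirichlet_algebra \<omega>. g = (\<lambda>s. dirichlet_one s + h s * g s)"
proof -
  let ?N = "{1::nat..}" and ?q = "coeff_norm \<omega> a"
  obtain b where b: "\<And>k. dirichlet_rep \<omega> (b k) (\<lambda>s. dirichlet_one s * h s ^ k)"
    "\<And>k. coeff_norm \<omega> (b k) \<le> \<omega> 1 * ?q ^ k"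
    using dirichlet_rep_power[OF w a] by metis
  have q: "0 \<le> ?q" by (rule coeff_norm_nonneg[OF w])
  define c where "c p = b (fst p) (snd p)" for p
  \<comment> \<open>The numerator makes \<open>g\<close> vanish off the half-plane, and the
    denominator is never 0 because \<open>h\<close> has modulus below 1 everywhere.\<close>
  define g where "g s = dirichlet_one s / (1 - h s)" for s
  have "summable (\<lambda>k. \<omega> 1 * ?q ^ k)"
    using q lt by (intro summable_mult summable_geometric) auto
  then have qsum: "(\<lambda>k. \<omega> 1 * ?q ^ k) summable_on UNIV"
    using q weight_nonneg[OF w, of 1] by (intro summable_nonneg_imp_summable_on) auto
  have nsum: "(\<lambda>k. coeff_norm \<omega> (b k)) summable_on UNIV"
    by (rule summable_on_comparison_test[OF qsum]) (use b(2) coeff_norm_nonneg[OF w] in auto)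
  have csum: "(\<lambda>p. cmod (c p) * \<omega> (snd p)) summable_on UNIV \<times> ?N"
    by (rule summable_on_SigmaI[where g = "\<lambda>k. coeff_norm \<omega> (b k)"])
      (use nsum coeff_norm_has_sum[OF b(1)] weight_nonneg[OF w] in \<open>auto simp: c_def\<close>)
  have "((\<lambda>p. c p * of_nat (snd p) powr (- s)) has_sum g s) (UNIV \<times> ?N)"
    if s: "s \<in> closed_right_half_plane" for s
  proof (rule has_sum_SigmaI)
    have "(\<lambda>p. cmod (c p * of_nat (snd p) powr (- s))) summable_on UNIV \<times> ?N"
    proof (rule summable_on_comparison_test[OF csum])
      fix p :: "nat \<times> nat" assume p: "p \<in> UNIV \<times> ?N"
      then show "cmod (c p * of_nat (snd p) powr (- s)) \<le> cmod (c p) * \<omega> (snd p)"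
        using norm_nat_powr_le_1[of s "snd p"] weight_ge_1[OF w, of "snd p"] s
        by (auto simp: norm_mult closed_right_half_plane_def intro!: mult_left_mono)
    qed auto
    then show "(\<lambda>p. c p * of_nat (snd p) powr (- s)) summable_on UNIV \<times> ?N"
      by (rule abs_summable_summable)
    have hs: "cmod (h s) < 1"
      using dirichlet_rep_norm_le[OF w a, of s] lt by simp
    have "(\<lambda>k. h s ^ k) sums (1 / (1 - h s))"
      by (rule geometric_sums[OF hs])
    moreover have "summable (\<lambda>k. norm (h s ^ k))"
      using hs by (simp add: norm_power summable_geometric)
    ultimately have "((\<lambda>k. h s ^ k) has_sum (1 / (1 - h s))) UNIV"
      by (intro norm_summable_imp_has_sum)
    then show "((\<lambda>k. dirichlet_one s * h s ^ k) has_sum g s) UNIV"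
      using s by (simp add: g_def dirichlet_one_def)
    fix k
    show "((\<lambda>n. c (k, n) * of_nat (snd (k, n)) powr (- s)) has_sum dirichlet_one s * h s ^ k) ?N"
      using dirichlet_rep_has_sum[OF b(1) s] by (simp add: c_def)
  qed
  moreover have "g s = 0" if "s \<notin> closed_right_half_plane" for s
    using that by (simp add: g_def dirichlet_one_def)
  ultimately obtain d where "dirichlet_rep \<omega> d g"
    using dirichlet_rep_regroup[OF w _ csum, of g] by auto
  moreover have "g s = dirichlet_one s + h s * g s" for s
  proof -
    have "h s \<noteq> 1"
      using dirichlet_rep_norm_le[OF w a, of s] lt by auto
    then show ?thesis
      by (simp add: g_def field_simps)
  qed
  ultimately show ?thesis
    by (auto simp: dirichlet_algebra_def fun_eq_iff intro!: bexI[of _ g])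
qed

section \<open>Polynomials in \<open>1 / n\<close> as functionals\<close>

text \<open>The disc contains all nodes \<open>1 / n\<close>, so compactness bounds a Lagrange
  polynomial at all of them at once.\<close>

lemma poly_bounded_on_unit_disc:
  fixes p :: "complex poly"
  shows "\<exists>B. \<forall>z. cmod z \<le> 1 \<longrightarrow> cmod (poly p z) \<le> B"
proof -
  have "compact (poly p ` cball 0 1)"
    by (intro compact_continuous_image continuous_intros) auto
  then have "bounded (poly p ` cball 0 1)"
    by (rule compact_imp_bounded)
  then show ?thesis
    unfolding bounded_iff by (metis imageI mem_cball_0)
qed

lemma interpolating_poly_reciprocals:
  fixes v :: "nat \<Rightarrow> complex"
  shows "\<exists>p. (\<forall>n\<in>{1..N}. poly p (1 / of_nat n) = v n) \<and>
             (\<forall>n>N. cmod (poly p (1 / of_nat n)) \<le> 1)"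
proof -
  \<comment> \<open>The Lagrange basis polynomials for the nodes \<open>1 / j\<close> with
    \<open>j\<close> in \<open>{1..N}\<close>.\<close>
  define L :: "nat \<Rightarrow> complex poly" where
    "L m = (\<Prod>j\<in>{1..N} - {m}. smult (inverse (1 / of_nat m - 1 / of_nat j)) [:- 1 / of_nat j, 1:])"
    for m
  have L: "poly (L m) (1 / of_nat n) = (if n = m then 1 else 0)"
    if "m \<in> {1..N}" "n \<in> {1..N}" for m n
  proof (cases "n = m")
    case True
    have "inverse (1 / of_nat m - 1 / of_nat j) * (1 / of_nat m - 1 / of_nat j) = (1::complex)"
      if "j \<in> {1..N} - {m}" for j
      using that \<open>m \<in> {1..N}\<close> by (intro left_inverse) (auto simp: divide_simps)
    then show ?thesis
      using True by (simp add: L_def poly_prod algebra_simps)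
  next
    case False
    then have "n \<in> {1..N} - {m}" using that by auto
    then show ?thesis
      using False by (auto simp: L_def poly_prod intro!: bexI[of _ n])
  qed
  obtain B where B: "\<And>m z. cmod z \<le> 1 \<Longrightarrow> cmod (poly (L m) z) \<le> B m"
    using poly_bounded_on_unit_disc[of "L _"] by metis
  \<comment> \<open>The extra factor \<open>(m * x) ^ k\<close> is 1 at \<open>x = 1 / m\<close>, so
    the interpolation is exact for every \<open>k\<close>; \<open>k\<close> stays free to make the
    values beyond \<open>N\<close> small.\<close>
  define P where "P k = (\<Sum>m=1..N. smult (v m * of_nat m ^ k) (monom 1 k * L m))" for k
  have P: "poly (P k) (1 / of_nat n) = (\<Sum>m=1..N. v m * (of_nat m / of_nat n) ^ k * poly (L m) (1 / of_nat n))"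
    for k n
    by (simp add: P_def poly_sum poly_monom power_divide mult_ac)
  have exact: "poly (P k) (1 / of_nat n) = v n" if n: "n \<in> {1..N}" for k n
  proof -
    have "poly (P k) (1 / of_nat n) = (\<Sum>m=1..N. if n = m then v m else 0)"
      unfolding P using n by (intro sum.cong refl) (simp add: L)
    then show ?thesis
      using n by simp
  qed
  \<comment> \<open>For \<open>m \<le> N < n\<close> the ratio \<open>m / n\<close> is at most
    \<open>q < 1\<close>. The bound is uniform in \<open>n\<close>, so one \<open>k\<close> serves
    all \<open>n > N\<close>.\<close>
  define q where "q = real N / real (N + 1)"
  define K where "K = (\<Sum>m=1..N. cmod (v m) * B m)"
  have small: "cmod (poly (P k) (1 / of_nat n)) \<le> K * q ^ k" if n: "n > N" for k n
  proof -
    have "cmod (v m * (of_nat m / of_nat n) ^ k * poly (L m) (1 / of_nat n)) \<le> cmod (v m) * B m * q ^ k"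
      if m: "m \<in> {1..N}" for m
    proof -
      have "real m * real (N + 1) \<le> real N * real n"
        using m n by (intro mult_mono) auto
      then have "real m / real n \<le> q"
        using n by (simp add: q_def divide_simps mult_ac)
      then have "cmod ((of_nat m / of_nat n) ^ k) \<le> q ^ k"
        by (simp add: norm_power norm_divide power_mono)
      moreover have "cmod (1 / of_nat n) \<le> 1"
        using n by (simp add: norm_divide)
      ultimately have "cmod (v m) * cmod ((of_nat m / of_nat n) ^ k) * cmod (poly (L m) (1 / of_nat n))
          \<le> cmod (v m) * q ^ k * B m"
        by (intro mult_mono mult_left_mono B mult_nonneg_nonneg) (auto simp: q_def)
      then show ?thesis
        by (simp add: norm_mult mult_ac)
    qed
    then show ?thesis
      unfolding P K_def sum_distrib_right by (intro sum_norm_le) auto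
  qed
  have "(\<lambda>k. K * q ^ k) \<longlonglongrightarrow> K * 0"
    by (intro tendsto_mult tendsto_const LIMSEQ_power_zero) (simp add: q_def)
  then have "\<forall>\<^sub>F k in sequentially. K * q ^ k < 1"
    by (intro order_tendstoD(2)[where y = "K * 0"]) auto
  then obtain k where "K * q ^ k < 1"
    by (auto simp: eventually_sequentially)
  then show ?thesis
    using exact small by (intro exI[of _ "P k"]) (fastforce intro: order_trans)
qed

text \<open>The sequence \<open>poly p (1 / n)\<close> acts as a functional of norm at most 1 that
  nearly attains the norm at \<open>a\<close>. Its value is left as an arbitrary sum
  \<open>t\<close>, to be identified later by \<open>poly_functional_has_sum\<close>.\<close>

lemma exists_norming_poly:
  assumes w: "weight \<omega>" and a: "(\<lambda>n. cmod (a n) * \<omega> n) summable_on {1..}" and e: "0 < e"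
  shows "\<exists>p. (\<forall>n\<ge>1. cmod (poly p (1 / of_nat n)) \<le> \<omega> n) \<and>
             (\<forall>t. ((\<lambda>n. a n * poly p (1 / of_nat n)) has_sum t) {1..} \<longrightarrow> coeff_norm \<omega> a - e \<le> cmod t)"
proof -
  have hs: "((\<lambda>n. cmod (a n) * \<omega> n) has_sum coeff_norm \<omega> a) {1..}"
    unfolding coeff_norm_def using a by (rule has_sum_infsum)
  \<comment> \<open>The mass beyond the finite part is lost twice, once as missing from the main sum
    and once as the error of the uncontrolled tail; hence \<open>e / 2\<close>.\<close>
  obtain F where F: "finite F" "F \<subseteq> {1..}"
    "dist (\<Sum>n\<in>F. cmod (a n) * \<omega> n) (coeff_norm \<omega> a) \<le> e / 2"
    using has_sum_finite_approximation[OF hs, of "e / 2"] e by auto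
  \<comment> \<open>Inserting 0 gives \<open>Max\<close> a value also when \<open>F\<close> is
    empty.\<close>
  define N where "N = Max (insert 0 F)"
  let ?S = "\<Sum>n=1..N. cmod (a n) * \<omega> n"
  have "F \<subseteq> {1..N}"
    using F(1,2) by (auto simp: N_def)
  then have "(\<Sum>n\<in>F. cmod (a n) * \<omega> n) \<le> ?S"
    using weight_nonneg[OF w] by (intro sum_mono2) auto
  with F(3) have S: "coeff_norm \<omega> a - e / 2 \<le> ?S"
    unfolding dist_real_def by linarith
  have diff: "{Suc 0..} - {Suc 0..N} = {N<..}" by auto
  have tail: "((\<lambda>n. cmod (a n) * \<omega> n) has_sum (coeff_norm \<omega> a - ?S)) {N<..}"
    using has_sum_Diff[OF hs has_sum_finite[of "{1..N}"]] by (simp add: diff)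
  \<comment> \<open>The factor \<open>cnj (sgn (a n))\<close> turns \<open>a n\<close> into its
    modulus. It has modulus 1, or is 0 when \<open>a n = 0\<close>, so the prescribed values respect
    the bound \<open>\<omega> n\<close>.\<close>
  obtain p where p: "\<And>n. n \<in> {1..N} \<Longrightarrow> poly p (1 / of_nat n) = cnj (sgn (a n)) * of_real (\<omega> n)"
    "\<And>n. n > N \<Longrightarrow> cmod (poly p (1 / of_nat n)) \<le> 1"
    using interpolating_poly_reciprocals[of N "\<lambda>n. cnj (sgn (a n)) * of_real (\<omega> n)"] by blast
  have p_le: "cmod (poly p (1 / of_nat n)) \<le> \<omega> n" if n: "1 \<le> n" for n
  proof (cases "n \<le> N")
    case True
    then show ?thesis
      using p(1)[of n] n weight_nonneg[OF w n] by (auto simp: norm_mult norm_sgn)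
  next
    case False
    then show ?thesis
      using p(2)[of n] weight_ge_1[OF w n] by auto
  qed
  have "coeff_norm \<omega> a - e \<le> cmod t"
    if t: "((\<lambda>n. a n * poly p (1 / of_nat n)) has_sum t) {1..}" for t
  proof -
    have "a n * poly p (1 / of_nat n) = of_real (cmod (a n) * \<omega> n)" if "n \<in> {1..N}" for n
    proof -
      have "a n * cnj (sgn (a n)) = of_real (cmod (a n))"
        using complex_norm_square[of "a n"]
        by (simp add: sgn_eq power2_eq_square divide_simps)
      then show ?thesis
        using p(1)[OF that] by (simp flip: mult.assoc)
    qed
    then have "(\<Sum>n=1..N. a n * poly p (1 / of_nat n)) = of_real ?S"
      by simp
    then have t2: "((\<lambda>n. a n * poly p (1 / of_nat n)) has_sum (t - of_real ?S)) {N<..}"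
      using has_sum_Diff[OF t has_sum_finite[of "{1..N}"]] by (simp add: diff)
    have le: "cmod (a n * poly p (1 / of_nat n)) \<le> cmod (a n) * \<omega> n" if "n \<in> {N<..}" for n
      using p_le[of n] that by (auto simp: norm_mult intro!: mult_left_mono)
    have "(\<lambda>n. cmod (a n * poly p (1 / of_nat n))) summable_on {N<..}"
      by (rule summable_on_comparison_test[OF has_sum_imp_summable[OF tail] le]) auto
    note hs2 = has_sum_infsum[OF this]
    have "cmod (t - of_real ?S) \<le> (\<Sum>\<^sub>\<infinity>n\<in>{N<..}. cmod (a n * poly p (1 / of_nat n)))"
      by (rule norm_has_sum_bound[OF hs2 t2])
    also have "\<dots> \<le> coeff_norm \<omega> a - ?S"
      by (rule has_sum_mono[OF hs2 tail le])
    finally have "cmod (t - of_real ?S) \<le> coeff_norm \<omega> a - ?S" .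
    moreover have "?S \<le> cmod t + cmod (t - of_real ?S)"
    proof -
      have "0 \<le> ?S" using weight_nonneg[OF w] by (intro sum_nonneg) auto
      then have "?S = cmod (of_real ?S)" by (simp only: norm_of_real abs_of_nonneg)
      also have "\<dots> = cmod (t - (t - of_real ?S))" by simp
      also have "\<dots> \<le> cmod t + cmod (t - of_real ?S)" by (rule norm_triangle_ineq4)
      finally show ?thesis .
    qed
    ultimately show ?thesis using S by linarith
  qed
  with p_le show ?thesis by blast
qed

section \<open>Pairing Dirichlet series with polynomials in \<open>1 / n\<close>\<close>

lemma has_sum_sum:
  fixes f :: "'i \<Rightarrow> 'a \<Rightarrow> 'b::topological_comm_monoid_add"
  assumes "\<And>i. i \<in> I \<Longrightarrow> (f i has_sum S i) A"
  shows "((\<lambda>x. \<Sum>i\<in>I. f i x) has_sum (\<Sum>i\<in>I. S i)) A"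
  using assms by (induction I rule: infinite_finite_induct) (auto intro: has_sum_add)

text \<open>Since \<open>n powr (- i) = (1 / n) ^ i\<close>, pairing the coefficients with
  \<open>poly p (1 / n)\<close> is a combination of the values of \<open>f\<close> at the integers
  \<open>i\<close>. These values depend on \<open>f\<close> alone, not on the choice of
  \<open>a\<close>.\<close>

lemma poly_functional_has_sum:
  assumes a: "dirichlet_rep \<omega> a f"
  shows "((\<lambda>n. a n * poly p (1 / of_nat n)) has_sum (\<Sum>i\<le>degree p. coeff p i * f (of_nat i))) {1..}"
proof -
  have "((\<lambda>n. \<Sum>i\<le>degree p. coeff p i * (a n * of_nat n powr (- of_nat i)))
          has_sum (\<Sum>i\<le>degree p. coeff p i * f (of_nat i))) {1..}"
    by (intro has_sum_sum has_sum_cmult_right dirichlet_rep_has_sum[OF a])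
      (auto simp: closed_right_half_plane_def)
  then show ?thesis
  proof (rule has_sum_cong[THEN iffD1, rotated])
    fix n :: nat assume "n \<in> {1..}"
    then have "of_nat n powr (- of_nat i) = (1 / of_nat n :: complex) ^ i" for i
      by (simp add: powr_minus powr_nat' power_divide inverse_eq_divide)
    then show "(\<Sum>i\<le>degree p. coeff p i * (a n * of_nat n powr (- of_nat i)))
        = a n * poly p (1 / of_nat n)"
      by (simp add: poly_altdef sum_distrib_left mult_ac)
  qed
qed

lemma poly_functional_le:
  assumes w: "weight \<omega>" and a: "dirichlet_rep \<omega> a f"
    and p: "\<And>n. 1 \<le> n \<Longrightarrow> cmod (poly p (1 / of_nat n)) \<le> \<omega> n"
  shows "cmod (\<Sum>i\<le>degree p. coeff p i * f (of_nat i)) \<le> coeff_norm \<omega> a"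
proof -
  have le: "cmod (a n * poly p (1 / of_nat n)) \<le> cmod (a n) * \<omega> n" if "n \<in> {1..}" for n
    using p[of n] that by (auto simp: norm_mult intro!: mult_left_mono)
  have "(\<lambda>n. cmod (a n * poly p (1 / of_nat n))) summable_on {1..}"
    by (rule summable_on_comparison_test[OF dirichlet_rep_summable[OF a] le]) auto
  note hs = has_sum_infsum[OF this]
  show ?thesis
    using norm_has_sum_bound[OF hs poly_functional_has_sum[OF a]]
      has_sum_mono[OF hs coeff_norm_has_sum[OF a] le] by simp
qed

text \<open>A norming polynomial for \<open>a\<close> gives a functional that sees only
  \<open>f\<close>. Its value is nearly the norm of \<open>a\<close>, yet bounded by the norm of
  \<open>b\<close>.\<close>

lemma coeff_norm_unique:
  assumes w: "weight \<omega>" and a: "dirichlet_rep \<omega> a f" and b: "dirichlet_rep \<omega> b f"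
  shows "coeff_norm \<omega> a = coeff_norm \<omega> b"
proof -
  have "coeff_norm \<omega> a \<le> coeff_norm \<omega> b"
    if a: "dirichlet_rep \<omega> a f" and b: "dirichlet_rep \<omega> b f" for a b
  proof (rule field_le_epsilon)
    fix e :: real assume "0 < e"
    from exists_norming_poly[OF w dirichlet_rep_summable[OF a] this] obtain p where
      p: "\<And>n. 1 \<le> n \<Longrightarrow> cmod (poly p (1 / of_nat n)) \<le> \<omega> n"
        "\<And>t. ((\<lambda>n. a n * poly p (1 / of_nat n)) has_sum t) {1..} \<Longrightarrow> coeff_norm \<omega> a - e \<le> cmod t"
      by blast
    from p(2)[OF poly_functional_has_sum[OF a]] poly_functional_le[OF w b p(1)]
    show "coeff_norm \<omega> a \<le> coeff_norm \<omega> b + e" by simp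
  qed
  from this[OF a b] this[OF b a] show ?thesis by simp
qed

lemma dirichlet_norm_eq:
  assumes w: "weight \<omega>" and a: "dirichlet_rep \<omega> a f"
  shows "dirichlet_norm \<omega> f = coeff_norm \<omega> a"
  unfolding dirichlet_norm_def coeff_norm_def[symmetric]
  using a coeff_norm_unique[OF w] by (intro the_equality) blast+

section \<open>Characters and the BSE-norm\<close>

lemma dirichlet_algebraE:
  assumes "weight \<omega>" "f \<in> dirichlet_algebra \<omega>"
  obtains a where "dirichlet_rep \<omega> a f" "dirichlet_norm \<omega> f = coeff_norm \<omega> a"
  using assms dirichlet_norm_eq by (auto simp: dirichlet_algebra_def)

lemma dirichlet_algebra_cmult:
  assumes "weight \<omega>" "f \<in> dirichlet_algebra \<omega>"
  shows "(\<lambda>s. c * f s) \<in> dirichlet_algebra \<omega>"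
    and "dirichlet_norm \<omega> (\<lambda>s. c * f s) = cmod c * dirichlet_norm \<omega> f"
proof -
  obtain a where a: "dirichlet_rep \<omega> a f" "dirichlet_norm \<omega> f = coeff_norm \<omega> a"
    using dirichlet_algebraE[OF assms] .
  note ca = dirichlet_rep_cmult[OF a(1), of c]
  show "(\<lambda>s. c * f s) \<in> dirichlet_algebra \<omega>"
    using ca by (auto simp: dirichlet_algebra_def)
  show "dirichlet_norm \<omega> (\<lambda>s. c * f s) = cmod c * dirichlet_norm \<omega> f"
    using dirichlet_norm_eq[OF assms(1) ca(1)] ca(2) a(2) by simp
qed

lemma dirichlet_one_in: "dirichlet_one \<in> dirichlet_algebra \<omega>"
  using dirichlet_rep_one by (auto simp: dirichlet_algebra_def)

lemma dirichlet_one_mult: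
  "f \<in> dirichlet_algebra \<omega> \<Longrightarrow> (\<lambda>s. dirichlet_one s * f s) = f"
  by (fastforce simp: dirichlet_algebra_def dirichlet_rep_def dirichlet_one_def indicator_def)

lemma dirichlet_algebra_add:
  "weight \<omega> \<Longrightarrow> f \<in> dirichlet_algebra \<omega> \<Longrightarrow> g \<in> dirichlet_algebra \<omega> \<Longrightarrow>
    (\<lambda>s. f s + g s) \<in> dirichlet_algebra \<omega>"
  using dirichlet_rep_add by (fastforce simp: dirichlet_algebra_def)

lemma dirichlet_algebra_mult:
  "weight \<omega> \<Longrightarrow> f \<in> dirichlet_algebra \<omega> \<Longrightarrow> g \<in> dirichlet_algebra \<omega> \<Longrightarrow>
    (\<lambda>s. f s * g s) \<in> dirichlet_algebra \<omega>"
  using dirichlet_rep_mult by (fastforce simp: dirichlet_algebra_def)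

lemma evaluation_in_char_space:
  assumes "weight \<omega>" "s \<in> closed_right_half_plane"
  shows "(\<lambda>f\<in>dirichlet_algebra \<omega>. f s) \<in> char_space (dirichlet_algebra \<omega>)"
  using assms dirichlet_one_in[of \<omega>]
  by (auto simp: char_space_def dirichlet_algebra_add dirichlet_algebra_mult
      dirichlet_algebra_cmult dirichlet_one_def intro!: bexI[of _ dirichlet_one])

text \<open>If the bound fails, dividing \<open>f\<close> by \<open>\<phi> f\<close> gives
  \<open>h\<close> of norm below 1 with \<open>\<phi> h = 1\<close>. Applying \<open>\<phi>\<close>
  to \<open>g = 1 + h * g\<close> then forces \<open>\<phi>\<close> to vanish at the unit, hence at
  \<open>f\<close>.\<close>

lemma char_space_le_norm:
  assumes w: "weight \<omega>" and \<phi>: "\<phi> \<in> char_space (dirichlet_algebra \<omega>)"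
    and f: "f \<in> dirichlet_algebra \<omega>"
  shows "cmod (\<phi> f) \<le> dirichlet_norm \<omega> f"
proof (rule ccontr)
  let ?A = "dirichlet_algebra \<omega>"
  assume less: "\<not> cmod (\<phi> f) \<le> dirichlet_norm \<omega> f"
  have add: "\<phi> (\<lambda>x. g x + h x) = \<phi> g + \<phi> h" and mult: "\<phi> (\<lambda>x. g x * h x) = \<phi> g * \<phi> h"
    if "g \<in> ?A" "h \<in> ?A" for g h
    using \<phi> that by (auto simp: char_space_def)
  have cmult: "\<phi> (\<lambda>x. c * g x) = c * \<phi> g" if "g \<in> ?A" for c g
    using \<phi> that by (auto simp: char_space_def)
  obtain a where a: "dirichlet_rep \<omega> a f" "dirichlet_norm \<omega> f = coeff_norm \<omega> a"
    using dirichlet_algebraE[OF w f] .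
  have nz: "\<phi> f \<noteq> 0"
    using less a(2) coeff_norm_nonneg[OF w, of a] by auto
  define h where "h s = inverse (\<phi> f) * f s" for s
  have h: "h \<in> ?A" and \<phi>h: "\<phi> h = 1"
    unfolding h_def using dirichlet_algebra_cmult[OF w f] cmult[OF f] nz by auto
  have "dirichlet_norm \<omega> h < 1"
    unfolding h_def dirichlet_algebra_cmult(2)[OF w f] using less nz
    by (simp add: norm_divide divide_simps)
  then obtain g where g: "g \<in> ?A" "g = (\<lambda>s. dirichlet_one s + h s * g s)"
    using dirichlet_algebraE[OF w h] dirichlet_neumann[OF w] by metis
  have "\<phi> g = \<phi> dirichlet_one + \<phi> h * \<phi> g"
    using add[OF dirichlet_one_in dirichlet_algebra_mult[OF w h g(1)]] mult[OF h g(1)] g(2) by simp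
  then have "\<phi> dirichlet_one = 0"
    by (simp add: \<phi>h)
  moreover have "\<phi> f = \<phi> dirichlet_one * \<phi> f"
    using mult[OF dirichlet_one_in f] by (simp add: dirichlet_one_mult[OF f])
  ultimately show False
    using nz by simp
qed

section \<open>Continuity of the Gelfand transform and the two inequalities for its BSE-norm\<close>

lemma continuous_map_gelfand_transform:
  assumes "f \<in> A"
  shows "continuous_map (gelfand_topology A) euclidean (gelfand_transform A f)"
  unfolding continuous_map_def topspace_gelfand_topology
proof (intro conjI allI impI)
  fix U :: "complex set" assume "openin euclidean U"
  then have "{\<phi> \<in> char_space A. gelfand_transform A f \<phi> \<in> U} \<in>
      {{\<phi> \<in> char_space A. gelfand_transform A f \<phi> \<in> U} | f U. f \<in> A \<and> open U}"
    using assms by auto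
  then show "openin (gelfand_topology A) {\<phi> \<in> char_space A. gelfand_transform A f \<phi> \<in> U}"
    unfolding gelfand_topology_def by (rule topology_generated_by_Basis)
qed auto

text \<open>A combination \<open>\<psi>\<close> of characters satisfies
  \<open>cmod (\<psi> f) \<le> C * dual_norm\<close> because \<open>f\<close> scaled to norm 1
  competes in the supremum. Any positive \<open>C\<close> above the norm is allowed, so that
  \<open>f = 0\<close> is covered.\<close>

lemma bse_bound_gelfand_transform:
  assumes w: "weight \<omega>" and f: "f \<in> dirichlet_algebra \<omega>"
    and C: "0 < C" "dirichlet_norm \<omega> f \<le> C"
  shows "bse_bound (dirichlet_algebra \<omega>) (dirichlet_norm \<omega>) (gelfand_transform (dirichlet_algebra \<omega>) f) C"
  unfolding bse_bound_def
proof (intro conjI C(1) allI impI)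
  let ?A = "dirichlet_algebra \<omega>" and ?N = "dirichlet_norm \<omega>"
  fix n and \<phi> :: "nat \<Rightarrow> (complex \<Rightarrow> complex) \<Rightarrow> complex" and c :: "nat \<Rightarrow> complex"
  assume \<phi>: "\<forall>i\<in>{1..n}. \<phi> i \<in> char_space ?A"
  define \<psi> where "\<psi> g = (\<Sum>i=1..n. c i * \<phi> i g)" for g
  define B where "B = (\<Sum>i=1..n. cmod (c i))"
  have le: "cmod (\<psi> g) \<le> B * ?N g" if "g \<in> ?A" for g
    unfolding \<psi>_def B_def sum_distrib_right
    using \<phi> char_space_le_norm[OF w _ that] by (intro sum_norm_le) (auto simp: norm_mult mult_left_mono)
  have B: "0 \<le> B"
    unfolding B_def by (intro sum_nonneg) auto
  \<comment> \<open>The real supremum dominates its members only on a bounded set; contractivity of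
    the characters supplies the bound.\<close>
  have bdd: "bdd_above {cmod (\<psi> g) | g. g \<in> ?A \<and> ?N g \<le> 1}"
  proof (rule bdd_aboveI[where M = B], safe)
    fix g assume g: "g \<in> ?A" "?N g \<le> 1"
    show "cmod (\<psi> g) \<le> B"
      using le[OF g(1)] mult_left_mono[OF g(2) B] by simp
  qed
  have dual: "cmod (\<psi> g) \<le> dual_norm ?A ?N \<psi>" if "g \<in> ?A" "?N g \<le> 1" for g
    unfolding dual_norm_def using that by (intro cSup_upper bdd) auto
  have N0: "0 \<le> ?N f"
    using dirichlet_algebraE[OF w f] coeff_norm_nonneg[OF w] by metis
  have scale: "\<psi> (\<lambda>s. t * f s) = t * \<psi> f" for t
    unfolding \<psi>_def sum_distrib_left using \<phi> f
    by (intro sum.cong) (auto simp: char_space_def)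
  \<comment> \<open>The zero function, written \<open>0 * f\<close>, lies in the unit ball.\<close>
  have d0: "0 \<le> dual_norm ?A ?N \<psi>"
    using dual[of "\<lambda>s. 0 * f s"] dirichlet_algebra_cmult[OF w f, of 0] scale[of 0] by simp
  have "cmod (\<psi> f) \<le> ?N f * dual_norm ?A ?N \<psi>"
  \<comment> \<open>When the norm is 0 no scaling is possible, but then \<open>le\<close> already
    gives \<open>\<psi> f = 0\<close>.\<close>
  proof (cases "?N f = 0")
    case True
    then show ?thesis using le[OF f] by simp
  next
    case False
    then have pos: "0 < ?N f" using N0 by simp
    let ?g = "\<lambda>s. of_real (inverse (?N f)) * f s"
    have "cmod (\<psi> ?g) \<le> dual_norm ?A ?N \<psi>"
      using pos by (intro dual dirichlet_algebra_cmult[OF w f])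
        (simp add: dirichlet_algebra_cmult[OF w f] norm_inverse del: of_real_inverse)
    then show ?thesis
      unfolding scale using pos by (simp add: norm_mult norm_divide field_simps)
  qed
  also have "\<dots> \<le> C * dual_norm ?A ?N \<psi>"
    by (rule mult_right_mono[OF C(2) d0])
  also have "\<psi> f = (\<Sum>i=1..n. c i * gelfand_transform ?A f (\<phi> i))"
    unfolding \<psi>_def gelfand_transform_def using \<phi> by (intro sum.cong) auto
  finally show "cmod (\<Sum>i=1..n. c i * gelfand_transform ?A f (\<phi> i))
      \<le> C * dual_norm ?A ?N (\<lambda>g. \<Sum>i=1..n. c i * \<phi> i g)"
    by (simp add: \<psi>_def[abs_def])
qed

text \<open>A norming polynomial is a combination of evaluations at \<open>0, 1, 2, ...\<close> with
  dual norm at most 1. The BSE inequality bounds its value at \<open>f\<close> by \<open>C\<close>,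
  and this value is within \<open>e\<close> of the norm.\<close>

lemma norm_le_bse_bound:
  assumes w: "weight \<omega>" and f: "f \<in> dirichlet_algebra \<omega>"
    and C: "bse_bound (dirichlet_algebra \<omega>) (dirichlet_norm \<omega>) (gelfand_transform (dirichlet_algebra \<omega>) f) C"
  shows "dirichlet_norm \<omega> f \<le> C"
proof (rule field_le_epsilon)
  let ?A = "dirichlet_algebra \<omega>" and ?N = "dirichlet_norm \<omega>"
  fix e :: real assume e: "0 < e"
  obtain a where a: "dirichlet_rep \<omega> a f" "?N f = coeff_norm \<omega> a"
    using dirichlet_algebraE[OF w f] .
  from exists_norming_poly[OF w dirichlet_rep_summable[OF a(1)] e] obtain p where
    p: "\<And>n. 1 \<le> n \<Longrightarrow> cmod (poly p (1 / of_nat n)) \<le> \<omega> n"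
      "\<And>t. ((\<lambda>n. a n * poly p (1 / of_nat n)) has_sum t) {1..} \<Longrightarrow> coeff_norm \<omega> a - e \<le> cmod t"
    by blast
  \<comment> \<open>\<open>bse_bound\<close> numbers the characters from 1 and the coefficients of
    \<open>p\<close> start at 0, hence the shift by one in \<open>n\<close>, \<open>c\<close> and
    \<open>\<phi>\<close>.\<close>
  define n where "n = Suc (degree p)"
  then have "1 \<le> n" by simp
  define c where "c i = coeff p (i - 1)" for i
  define \<phi> where "\<phi> i = (\<lambda>g\<in>?A. g (of_nat (i - 1)))" for i :: nat
  define \<psi> where "\<psi> = (\<lambda>g. \<Sum>i=1..n. c i * \<phi> i g)"
  have \<phi>: "\<phi> i \<in> char_space ?A" for i
    unfolding \<phi>_def by (rule evaluation_in_char_space[OF w]) (simp add: closed_right_half_plane_def)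
  have \<psi>: "\<psi> g = (\<Sum>i\<le>degree p. coeff p i * g (of_nat i))" if "g \<in> ?A" for g
  proof -
    have "\<psi> g = (\<Sum>i\<in>Suc ` {..degree p}. c i * \<phi> i g)"
      by (simp add: \<psi>_def n_def image_Suc_atMost)
    also have "\<dots> = (\<Sum>i\<le>degree p. coeff p i * g (of_nat i))"
      using that by (subst sum.reindex) (auto simp: c_def \<phi>_def)
    finally show ?thesis .
  qed
  have le: "cmod (\<psi> g) \<le> ?N g" if "g \<in> ?A" for g
    using dirichlet_algebraE[OF w that] poly_functional_le[OF w _ p(1)] \<psi>[OF that] by metis
  have "dual_norm ?A ?N \<psi> \<le> 1"
    unfolding dual_norm_def
  proof (rule cSup_least)
    \<comment> \<open>The zero function shows that the supremum is over a nonempty set.\<close>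
    have "?N (\<lambda>s. 0 * f s) = 0" "(\<lambda>s. 0 * f s) \<in> ?A"
      using dirichlet_algebra_cmult[OF w f, of 0] by auto
    then show "{cmod (\<psi> g) | g. g \<in> ?A \<and> ?N g \<le> 1} \<noteq> {}"
      by fastforce
  qed (use le in fastforce)
  moreover have "0 < C" and "cmod (\<Sum>i=1..n. c i * gelfand_transform ?A f (\<phi> i)) \<le> C * dual_norm ?A ?N \<psi>"
    using C \<phi> \<open>1 \<le> n\<close> unfolding bse_bound_def \<psi>_def by auto
  moreover have "(\<Sum>i=1..n. c i * gelfand_transform ?A f (\<phi> i)) = \<psi> f"
    using \<phi> by (simp add: \<psi>_def gelfand_transform_def)
  ultimately have "cmod (\<psi> f) \<le> C"
    by (metis less_imp_le mult_left_le order_trans)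
  moreover have "coeff_norm \<omega> a - e \<le> cmod (\<psi> f)"
    using p(2)[OF poly_functional_has_sum[OF a(1)]] \<psi>[OF f] by simp
  ultimately show "?N f \<le> C + e"
    using a(2) by simp
qed

theorem theorem2p3:
  fixes \<omega> :: "nat \<Rightarrow> real"
  assumes "weight \<omega>"
  shows "\<forall>f\<in>dirichlet_algebra \<omega>.
    bse_function (dirichlet_algebra \<omega>) (dirichlet_norm \<omega>)
      (gelfand_transform (dirichlet_algebra \<omega>) f) \<and>
    bse_norm (dirichlet_algebra \<omega>) (dirichlet_norm \<omega>)
      (gelfand_transform (dirichlet_algebra \<omega>) f) = dirichlet_norm \<omega> f"
proof (intro ballI conjI)
  fix f assume f: "f \<in> dirichlet_algebra \<omega>"
  let ?P = "bse_bound (dirichlet_algebra \<omega>) (dirichlet_norm \<omega>)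
    (gelfand_transform (dirichlet_algebra \<omega>) f)" and ?N = "dirichlet_norm \<omega> f"
  have N0: "0 \<le> ?N"
    using dirichlet_algebraE[OF assms f] coeff_norm_nonneg[OF assms] by metis
  note bound = bse_bound_gelfand_transform[OF assms f]
  show "bse_function (dirichlet_algebra \<omega>) (dirichlet_norm \<omega>)
      (gelfand_transform (dirichlet_algebra \<omega>) f)"
    unfolding bse_function_def
    using continuous_map_gelfand_transform[OF f] bound[of "?N + 1"] N0 by auto
  \<comment> \<open>The infimum is approached from above since \<open>bse_bound\<close> requires \<open>0 < C\<close>: it is not attained at \<open>f = 0\<close>.\<close>
  show "bse_norm (dirichlet_algebra \<omega>) (dirichlet_norm \<omega>)
      (gelfand_transform (dirichlet_algebra \<omega>) f) = ?N"
    unfolding bse_norm_def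
  proof (rule cInf_eq)
    fix y assume y: "\<And>x. x \<in> {C. ?P C} \<Longrightarrow> y \<le> x"
    show "y \<le> ?N"
    proof (rule field_le_epsilon)
      fix e :: real assume "0 < e"
      then show "y \<le> ?N + e"
        using N0 by (intro y) (auto intro!: bound)
    qed
  qed (use norm_le_bse_bound[OF assms f] in auto)
qed

end
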